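(* Let $b\geq 3$ and $t\geq 2$ be integers having the same prime divisors, and let $D\subseteq\{0,1,\ldots,b-1\}$ with $\#D\geq 2$. Let $\psi:\mathbb{N}\to(0,\infty)$ satisfy $\psi(n)\le b^{-\lceil\alpha_{2}n\rceil-1}$ for all sufficiently large $n$. (i) If $D$ contains neither $0$ nor $b-1$, then $W_{t}(\psi)\cap C(b,D)=\emptyset$. (ii) Suppose in addition that $b$ and $t$ are multiplicatively independent (i.e. $\log b/\log t\notin\mathbb{Q}$) and that $D\subseteq\{0,1,\ldots,b-1\}\setminus(D_{1}\cup D_{2})$. Then for every real $s\geq 0$, $$\mathcal{H}^{s}(W_{t}(\psi)\cap C(b,D))=0\quad\text{if}\quad \sum_{n=1}^{\infty}\psi(n)^{s}\,b^{\alpha_{1}\gamma n}<\infty.$$ Moreover, if $\alpha_{1}\in\mathbb{N}$, then $W_{t}(\psi)\cap C(b,D)=W_{b^{\alpha_{1}}}(\psi)\cap C(b,D)$.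
   Context: $C(b,D)$ denotes the set of real numbers in $[0,1]$ having a base-$b$ expansion all of whose digits lie in $D$. For an integer $u\geq2$ and $\psi:\mathbb{N}\to(0,\infty)$, $W_{u}(\psi)=\{x\in[0,1]: |x-p/u^{n}|<\psi(n)\text{ for infinitely many }(p,n)\in\mathbb{Z}\times\mathbb{N}\}$. $\gamma=\log\#D/\log b$. $\mathcal{H}^{s}$ is $s$-dimensional Hausdorff measure. For a prime $q$, $v_{q}(m)$ is the largest integer $v$ with $q^{v}\mid m$. $\alpha_{1}=\min\{v_{q}(t)/v_{q}(b): q \text{ prime}, q\mid b\}$ and $\alpha_{2}=\max\{v_{q}(t)/v_{q}(b): q\text{ prime}, q\mid b\}$. Let $b_{*}=b\big/\prod q^{v_{q}(b)}$, the product over the primes $q\mid b$ with $v_{q}(t)/v_{q}(b)>\alpha_{1}$ (equivalently $b_{*}=\prod q^{v_q(b)}$ over primes $q\mid b$ with $v_{q}(t)/v_{q}(b)=\alpha_{1}$). Then $D_{1}=\{kb_{*}: 1\le k\le b/b_{*}-1\}$ and $D_{2}=\{kb_{*}-1: 1\le k\le b/b_{*}-1\}$. *)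

theory Defs
  imports "HOL-Analysis.Analysis" "HOL-Computational_Algebra.Computational_Algebra"
begin

text \<open>
  The Hausdorff measure is normalised without a volume constant.  The convention is
  \<open>diam(U)^0 = 1\<close> for nonempty \<open>U\<close> and \<open>0\<close> for \<open>U = {}\<close>; the case distinctions are needed
  because \<open>0 powr 0 = 0\<close>.  Covering sets are required to be bounded because \<^const>\<open>diameter\<close>
  is \<open>0\<close> on unbounded sets.
\<close>

definition diam_power :: "real \<Rightarrow> 'a::metric_space set \<Rightarrow> ennreal" where
  "diam_power s U = (if U = {} then 0 else if s = 0 then 1 else ennreal (diameter U powr s))"

definition hausdorff_content :: "real \<Rightarrow> real \<Rightarrow> 'a::metric_space set \<Rightarrow> ennreal" where
  "hausdorff_content s \<delta> A =
     (INF U \<in> {U :: nat \<Rightarrow> 'a set.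
                 A \<subseteq> (\<Union>i. U i) \<and> (\<forall>i. bounded (U i) \<and> diameter (U i) \<le> \<delta>)}.
        \<Sum>i. diam_power s (U i))"

definition hausdorff_measure :: "real \<Rightarrow> 'a::metric_space set \<Rightarrow> ennreal" where
  "hausdorff_measure s A = (SUP \<delta> \<in> {0<..}. hausdorff_content s \<delta> A)"

definition digit_set :: "nat \<Rightarrow> nat set \<Rightarrow> real set" where
  "digit_set b D =
     {x \<in> {0..1}. \<exists>d :: nat \<Rightarrow> nat. (\<forall>i. d i \<in> D) \<and> (\<lambda>i. real (d i) / real b ^ Suc i) sums x}"

text \<open>Here and below the index \<open>n\<close> ranges over the positive integers.\<close>

definition W :: "nat \<Rightarrow> (nat \<Rightarrow> real) \<Rightarrow> real set" where
  "W u \<psi> =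
     {x \<in> {0..1}. infinite {(p :: int, n :: nat). n \<ge> 1 \<and> \<bar>x - of_int p / real u ^ n\<bar> < \<psi> n}}"

definition dim_exponent :: "nat \<Rightarrow> nat set \<Rightarrow> real" where
  "dim_exponent b D = ln (real (card D)) / ln (real b)"

definition val_ratio :: "nat \<Rightarrow> nat \<Rightarrow> nat \<Rightarrow> real" where
  "val_ratio b t q = real (multiplicity q t) / real (multiplicity q b)"

definition alpha1 :: "nat \<Rightarrow> nat \<Rightarrow> real" where
  "alpha1 b t = Min (val_ratio b t ` prime_factors b)"

definition alpha2 :: "nat \<Rightarrow> nat \<Rightarrow> real" where
  "alpha2 b t = Max (val_ratio b t ` prime_factors b)"

definition b_star :: "nat \<Rightarrow> nat \<Rightarrow> nat" where
  "b_star b t =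
     b div (\<Prod>q \<in> {q \<in> prime_factors b. val_ratio b t q > alpha1 b t}. q ^ multiplicity q b)"

text \<open>The divisions are exact, and the subtractions do not truncate for \<open>b \<ge> 1\<close>.\<close>

definition D1 :: "nat \<Rightarrow> nat \<Rightarrow> nat set" where
  "D1 b t = {k * b_star b t | k. 1 \<le> k \<and> k \<le> b div b_star b t - 1}"

definition D2 :: "nat \<Rightarrow> nat \<Rightarrow> nat set" where
  "D2 b t = {k * b_star b t - 1 | k. 1 \<le> k \<and> k \<le> b div b_star b t - 1}"

end

theory Submission imports Defs begin

text \<open>
  Since \<open>t ^ n\<close> divides \<open>b ^ m\<close> with \<open>m = \<lceil>\<alpha>\<^sub>2 n\<rceil>\<close>, a fraction \<open>p / t ^ n\<close> within \<open>b ^ (-m-1)\<close>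
  of a point \<open>x\<close> of the digit set is \<open>P / b ^ m\<close>, where \<open>P\<close> is \<open>N\<close> or \<open>N + 1\<close> and \<open>N\<close> is
  the integer formed by the first \<open>m\<close> digits of \<open>x\<close>.  If \<open>0\<close> and \<open>b - 1\<close> are not digits,
  \<open>x\<close> is too far from both.  In general, as long as the exponent \<open>j\<close> in
  \<open>p / t ^ n = P / b ^ j\<close> is at least \<open>\<alpha>\<^sub>1 n + 1\<close>, the number \<open>b\<^sub>*\<close> divides \<open>P\<close>; as the digits avoid
  \<open>D\<^sub>1 \<union> D\<^sub>2\<close>, this forces \<open>b\<close> to divide \<open>P\<close>, and \<open>j\<close> can be lowered.  So \<open>p / t ^ n\<close> is determined, up
  to two choices, by the first \<open>\<lceil>\<alpha>\<^sub>1 n\<rceil>\<close> digits of \<open>x\<close>, and the first Borel--Cantelli argument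
  with these centres gives the claim on the Hausdorff measure.
\<close>

section \<open>A Hausdorff--Cantelli lemma\<close>

lemma diameter_le_of_dist:
  fixes A :: "'a::metric_space set"
  assumes "0 \<le> d" "\<And>x y. x \<in> A \<Longrightarrow> y \<in> A \<Longrightarrow> dist x y \<le> d"
  shows "diameter A \<le> d"
  using assms by (auto simp: diameter_def intro!: cSUP_least)

text \<open>For \<open>r\<close> at most \<open>0\<close> the ball is empty and costs
  \<open>0\<close>; for \<open>s = 0\<close> and \<open>r > 0\<close> both sides are
  \<open>1\<close>.\<close>

lemma diam_power_ball_le:
  fixes c :: "'a::metric_space"
  assumes "s \<ge> 0"
  shows "diam_power s (ball c r) \<le> ennreal (2 powr s * r powr s)"
proof (cases "ball c r = {}")
  case False
  then have r: "r > 0" by (simp add: ball_eq_empty not_le)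
  have "diameter (ball c r) \<le> 2 * r"
    by (rule diameter_le_of_dist) (use r in \<open>auto, smt (verit) dist_triangle2 dist_commute\<close>)
  then have "diameter (ball c r) powr s \<le> (2 * r) powr s"
    using assms by (intro powr_mono2) (auto simp: diameter_ge_0)
  then show ?thesis using r False
    by (auto simp: diam_power_def powr_mult intro!: ennreal_leI)
qed (simp add: diam_power_def)

text \<open>For every \<open>N\<close>, the balls of radius \<open>r n\<close> about the points of
  \<open>S n\<close> with \<open>n \<ge> N\<close> cover \<open>A\<close>, and their total cost is
  at most \<open>2 powr s\<close> times a tail of the convergent series.\<close>

lemma hausdorff_measure_limsup_balls_eq_0:
  fixes S :: "nat \<Rightarrow> 'a::metric_space set"
  assumes s: "s \<ge> 0" and fin: "\<And>n. finite (S n)"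
    and A: "\<And>x. x \<in> A \<Longrightarrow> \<exists>\<^sub>\<infinity>n. \<exists>c\<in>S n. dist c x < r n"
    and sm: "summable (\<lambda>n. real (card (S n)) * r n powr s)"
    and r0: "r \<longlonglongrightarrow> 0"
  shows "hausdorff_measure s A = 0"
proof -
  let ?h = "\<lambda>n. real (card (S n)) * r n powr s"
  have "hausdorff_content s \<delta> A \<le> ennreal \<epsilon>" if "\<delta> > 0" "\<epsilon> > 0" for \<delta> \<epsilon>
  proof -
    have "\<forall>\<^sub>F n in sequentially. r n < \<delta> / 2"
      using order_tendstoD(2)[OF r0, of "\<delta> / 2"] that by simp
    \<comment> \<open>Dividing by \<open>2 powr s\<close> makes up for passing from radii to
      diameters.\<close>
    moreover have "(\<lambda>N. \<Sum>i. ?h (i + N)) \<longlonglongrightarrow> 0"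
      by (rule suminf_exist_split2[OF sm])
    then have "\<forall>\<^sub>F N in sequentially. (\<Sum>i. ?h (i + N)) < \<epsilon> / 2 powr s"
      using order_tendstoD(2)[of _ 0 sequentially "\<epsilon> / 2 powr s"] that by simp
    ultimately have "\<forall>\<^sub>F N in sequentially. (\<forall>n\<ge>N. r n < \<delta> / 2) \<and> (\<Sum>i. ?h (i + N)) < \<epsilon> / 2 powr s"
      by (intro eventually_conj) (simp_all add: eventually_all_ge_at_top)
    then obtain N where N: "\<And>n. n \<ge> N \<Longrightarrow> r n < \<delta> / 2"
      and tail: "(\<Sum>i. ?h (i + N)) < \<epsilon> / 2 powr s"
      using eventually_happens'[OF sequentially_bot] by blast
    have "\<forall>n. \<exists>g. bij_betw g {..<card (S n)} (S n)"
      using ex_bij_betw_nat_finite[OF fin] unfolding atLeast0LessThan by blast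
    then obtain g where g: "\<And>n. bij_betw (g n) {..<card (S n)} (S n)"
      by metis
    \<comment> \<open>The cover is indexed by pairs; surplus indices \<open>j\<close> get the empty
      set, which costs \<open>0\<close> even for \<open>s = 0\<close>. \<open>prod_decode\<close>
      then turns the pairs into one sequence.\<close>
    define V where
      "V = (\<lambda>(i, j). if j < card (S (i + N)) then ball (g (i + N) j) (r (i + N)) else {})"
    have V: "bounded (V q) \<and> diameter (V q) \<le> \<delta>" for q
    proof (cases q)
      case (Pair i j)
      have "diameter (ball c (r (i + N))) \<le> \<delta>" for c :: 'a
      proof (rule diameter_le_of_dist)
        fix x y assume "x \<in> ball c (r (i + N))" "y \<in> ball c (r (i + N))"
        then show "dist x y \<le> \<delta>"
          using N[of "i + N"] dist_triangle3[of x y c] by simp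
      qed (use \<open>\<delta> > 0\<close> in simp)
      then show ?thesis using Pair \<open>\<delta> > 0\<close> by (auto simp: V_def diameter_def)
    qed
    have cov: "A \<subseteq> (\<Union>k. V (prod_decode k))"
    proof
      fix x assume "x \<in> A"
      then obtain n c where n: "n \<ge> N" "c \<in> S n" "dist c x < r n"
        using A[of x] unfolding INFM_nat_le by blast
      have "c \<in> g n ` {..<card (S n)}"
        using bij_betw_imp_surj_on[OF g[of n]] n by simp
      then obtain j where j: "j < card (S n)" "g n j = c" by blast
      have "x \<in> V (n - N, j)" using n j by (simp add: V_def)
      then have "x \<in> V (prod_decode (prod_encode (n - N, j)))" by simp
      then show "x \<in> (\<Union>k. V (prod_decode k))" by blast
    qed
    have inner: "(\<Sum>j. diam_power s (V (i, j))) \<le> ennreal (2 powr s * ?h (i + N))" for i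
    proof -
      have "(\<Sum>j. diam_power s (V (i, j))) = (\<Sum>j<card (S (i + N)). diam_power s (V (i, j)))"
        by (intro suminf_finite) (auto simp: V_def diam_power_def)
      also have "\<dots> \<le> (\<Sum>j<card (S (i + N)). ennreal (2 powr s * r (i + N) powr s))"
        by (intro sum_mono) (auto simp: V_def intro: diam_power_ball_le[OF s])
      also have "\<dots> = ennreal (2 powr s * ?h (i + N))"
        by (simp add: ennreal_mult' ennreal_of_nat_eq_real_of_nat mult_ac)
      finally show ?thesis .
    qed
    have sm': "summable (\<lambda>i. 2 powr s * ?h (i + N))"
      using sm by (intro summable_mult summable_ignore_initial_segment)
    have "hausdorff_content s \<delta> A \<le> (\<Sum>k. diam_power s (V (prod_decode k)))"
      unfolding hausdorff_content_def using cov V by (intro INF_lower) auto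
    also have "\<dots> = (\<Sum>i. \<Sum>j. diam_power s (V (i, j)))"
      using suminf_ennreal_2dimen[of "\<lambda>i. \<Sum>j. diam_power s (V (i, j))" "\<lambda>q. diam_power s (V q)"]
      by (simp add: comp_def)
    also have "\<dots> \<le> (\<Sum>i. ennreal (2 powr s * ?h (i + N)))"
      by (intro suminf_le inner) auto
    also have "\<dots> = ennreal (\<Sum>i. 2 powr s * ?h (i + N))"
      using sm' by (intro suminf_ennreal2) auto
    also have "\<dots> \<le> ennreal \<epsilon>"
      using tail sm by (subst suminf_mult)
        (auto intro!: ennreal_leI summable_ignore_initial_segment simp: field_simps)
    finally show ?thesis .
  qed
  then have "hausdorff_content s \<delta> A = 0" if "\<delta> > 0" for \<delta>
    using that by (metis ennreal_le_epsilon add.left_neutral le_zero_eq)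
  then show ?thesis
    unfolding hausdorff_measure_def by (simp add: SUP_eq_const)
qed

section \<open>Digit expansions\<close>

text \<open>Horner's scheme: the integer with base-\<open>b\<close> digits \<open>d 0\<close>, ...,
  \<open>d (m - 1)\<close>, the most significant first.\<close>

primrec digit_prefix :: "nat \<Rightarrow> (nat \<Rightarrow> nat) \<Rightarrow> nat \<Rightarrow> nat" where
  "digit_prefix b d 0 = 0"
| "digit_prefix b d (Suc m) = b * digit_prefix b d m + d m"

lemma digit_prefix_eq_sum:
  assumes "b > 0"
  shows "real (digit_prefix b d m) / real b ^ m = (\<Sum>i<m. real (d i) / real b ^ Suc i)"
  using assms by (induction m) (auto simp: field_simps)

text \<open>The difference is the rescaled series of the digits from index \<open>m\<close> on. It
  is compared termwise with the geometric series whose digits are all \<open>l\<close> or all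
  \<open>h\<close>.\<close>

lemma digit_tail_bounds:
  assumes b: "b \<ge> 2" and x: "(\<lambda>i. real (d i) / real b ^ Suc i) sums x"
    and d: "\<And>i. l \<le> d i" "\<And>i. d i \<le> h"
  shows "real l / (real b - 1) \<le> real b ^ m * x - digit_prefix b d m"
    and "real b ^ m * x - digit_prefix b d m \<le> real h / (real b - 1)"
proof -
  have geo: "(\<lambda>i. c / real b ^ Suc (i + m)) sums (c / (real b - 1) / real b ^ m)" for c :: real
  proof -
    have *: "(\<lambda>i. c / real b ^ Suc m * (1 / real b) ^ i) sums (c / real b ^ Suc m * (1 / (1 - 1 / real b)))"
      using b by (intro sums_mult geometric_sums) auto
    have lim: "c / real b ^ Suc m * (1 / (1 - 1 / real b)) = c / (real b - 1) / real b ^ m"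
      using b by (simp add: divide_simps algebra_simps)
    have terms: "c / real b ^ Suc m * (1 / real b) ^ i = c / real b ^ Suc (i + m)" for i
      by (simp add: power_add power_one_over field_simps)
    show ?thesis using * unfolding terms lim .
  qed
  have tl: "(\<lambda>i. real (d (i + m)) / real b ^ Suc (i + m)) sums (x - digit_prefix b d m / real b ^ m)"
    using x b by (subst sums_iff_shift) (simp add: digit_prefix_eq_sum)
  have bm: "real b ^ m > 0" using b by simp
  have e: "real b ^ m * x - digit_prefix b d m = real b ^ m * (x - digit_prefix b d m / real b ^ m)"
    using bm by (simp add: field_simps)
  have "real l / (real b - 1) / real b ^ m \<le> x - digit_prefix b d m / real b ^ m"
    by (rule sums_le[OF _ geo tl]) (use d in \<open>auto intro!: divide_right_mono\<close>)
  then show "real l / (real b - 1) \<le> real b ^ m * x - digit_prefix b d m"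
    unfolding e using bm by (subst (asm) pos_divide_le_eq) (auto simp: mult.commute)
  have "x - digit_prefix b d m / real b ^ m \<le> real h / (real b - 1) / real b ^ m"
    by (rule sums_le[OF _ tl geo]) (use d in \<open>auto intro!: divide_right_mono\<close>)
  then show "real b ^ m * x - digit_prefix b d m \<le> real h / (real b - 1)"
    unfolding e using bm by (subst (asm) pos_le_divide_eq) (auto simp: mult.commute)
qed

definition digit_prefixes :: "nat \<Rightarrow> nat set \<Rightarrow> nat \<Rightarrow> nat set" where
  "digit_prefixes b D m = {digit_prefix b d m | d. \<forall>i. d i \<in> D}"

text \<open>A prefix of length \<open>Suc m\<close> is determined by one of length \<open>m\<close>
  and one more digit.\<close>

lemma digit_prefixes_finite_card:
  assumes "finite D"
  shows "finite (digit_prefixes b D m) \<and> card (digit_prefixes b D m) \<le> card D ^ m"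
proof (induction m)
  case 0
  have "digit_prefixes b D 0 \<subseteq> {0}" by (auto simp: digit_prefixes_def)
  then show ?case by (metis card_mono card.empty card_insert_disjoint empty_iff finite.emptyI
        finite_insert finite_subset One_nat_def power_0)
next
  case (Suc m)
  let ?T = "(\<lambda>(u, c). b * u + c) ` (digit_prefixes b D m \<times> D)"
  have sub: "digit_prefixes b D (Suc m) \<subseteq> ?T"
    by (fastforce simp: digit_prefixes_def)
  have fin: "finite (digit_prefixes b D m \<times> D)" using Suc assms by simp
  have "card ?T \<le> card (digit_prefixes b D m \<times> D)" by (rule card_image_le[OF fin])
  also have "\<dots> \<le> card D ^ Suc m" using Suc by (simp add: card_cartesian_product mult.commute)
  finally show ?case using sub fin by (meson card_mono finite_imageI finite_subset le_trans)
qed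

section \<open>Valuations\<close>

lemma
  assumes "q \<in> prime_factors b"
  shows alpha1_le_val_ratio: "alpha1 b t \<le> val_ratio b t q"
    and val_ratio_le_alpha2: "val_ratio b t q \<le> alpha2 b t"
  using assms by (auto simp: alpha1_def alpha2_def)

lemma multiplicity_pos_of_prime_factor:
  "q \<in> prime_factors (b::nat) \<Longrightarrow> multiplicity q b > 0"
  by (simp add: prime_factors_multiplicity)

lemma prime_factors_nonempty:
  assumes "(b::nat) \<ge> 2"
  shows "prime_factors b \<noteq> {}"
proof -
  obtain q where "prime q" "q dvd b" using assms prime_factor_nat[of b] by auto
  then have "q \<in> prime_factors b" using assms by (simp add: in_prime_factors_iff)
  then show ?thesis by blast
qed

lemma alpha1_pos:
  assumes "b \<ge> 2" "prime_factors b = prime_factors t"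
  shows "0 < alpha1 b t"
proof -
  have "prime_factors b \<noteq> {}" by (rule prime_factors_nonempty[OF assms(1)])
  moreover have "val_ratio b t q > 0" if "q \<in> prime_factors b" for q
    using multiplicity_pos_of_prime_factor[of q b] multiplicity_pos_of_prime_factor[of q t] that assms(2)
    by (simp add: val_ratio_def)
  ultimately show ?thesis by (simp add: alpha1_def)
qed

lemma alpha1_le_alpha2:
  assumes "b \<ge> 2"
  shows "alpha1 b t \<le> alpha2 b t"
proof -
  obtain q where "q \<in> prime_factors b" using prime_factors_nonempty[OF assms] by blast
  then show ?thesis using alpha1_le_val_ratio[of q b t] val_ratio_le_alpha2[of q b t] by linarith
qed

text \<open>For each prime q dividing \<open>b\<close>, n v_q(t) is at most alpha2 n v_q(b), hence
  at most m v_q(b); other primes divide neither number.\<close>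

lemma t_power_dvd_b_power:
  assumes "b > 0" "t > 0" "prime_factors b = prime_factors t" "alpha2 b t * real n \<le> real m"
  shows "t ^ n dvd b ^ m"
proof (rule multiplicity_le_imp_dvd)
  fix q :: nat assume q: "prime q"
  show "multiplicity q (t ^ n) \<le> multiplicity q (b ^ m)"
  proof (cases "q \<in> prime_factors b")
    case True
    let ?v = "real (multiplicity q b)"
    have v: "?v > 0" using multiplicity_pos_of_prime_factor[OF True] by simp
    have "real n * real (multiplicity q t) = real n * val_ratio b t q * ?v"
      using v by (simp add: val_ratio_def)
    also have "\<dots> \<le> real n * alpha2 b t * ?v"
      using val_ratio_le_alpha2[OF True] v by (intro mult_right_mono mult_left_mono) auto
    also have "\<dots> \<le> real m * ?v" using assms v by (intro mult_right_mono) (auto simp: mult.commute)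
    finally have "n * multiplicity q t \<le> m * multiplicity q b"
      by (simp only: of_nat_le_iff flip: of_nat_mult)
    then show ?thesis using q assms by (simp add: prime_elem_multiplicity_power_distrib)
  next
    case False
    then have "q \<notin> prime_factors t" using assms(3) by simp
    then have "multiplicity q t = 0" using q by (simp add: prime_factors_multiplicity)
    then show ?thesis using q assms by (simp add: prime_elem_multiplicity_power_distrib)
  qed
qed (use assms in auto)

text \<open>The minimal ratio bounds v_q(t) from below by a v_q(b). This serves to rewrite fractions
  over \<open>(b ^ a) ^ n\<close> as fractions over \<open>t ^ n\<close>.\<close>

lemma b_power_dvd_t:
  assumes "b > 0" "t > 0" "prime_factors b = prime_factors t" "real a \<le> alpha1 b t"
  shows "b ^ a dvd t"
proof (rule multiplicity_le_imp_dvd)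
  fix q :: nat assume q: "prime q"
  show "multiplicity q (b ^ a) \<le> multiplicity q t"
  proof (cases "q \<in> prime_factors b")
    case True
    let ?v = "real (multiplicity q b)"
    have v: "?v > 0" using multiplicity_pos_of_prime_factor[OF True] by simp
    have "real a * ?v \<le> val_ratio b t q * ?v"
      using alpha1_le_val_ratio[OF True, of t] assms v by (intro mult_right_mono) auto
    also have "\<dots> = real (multiplicity q t)" using v by (simp add: val_ratio_def)
    finally have "a * multiplicity q b \<le> multiplicity q t"
      by (simp only: of_nat_le_iff flip: of_nat_mult)
    then show ?thesis using q assms by (simp add: prime_elem_multiplicity_power_distrib)
  next
    case False
    then have "multiplicity q b = 0" using q by (simp add: prime_factors_multiplicity)
    then show ?thesis using q assms by (simp add: prime_elem_multiplicity_power_distrib)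
  qed
qed (use assms in auto)

text \<open>As \<open>alpha1\<close> is the minimal ratio, every prime of \<open>b\<close> has a
  ratio equal to it or larger, and the division removes exactly the second kind. The valuations of
  \<open>b_star\<close> can be read off this form.\<close>

lemma b_star_eq_prod:
  assumes "b > 0"
  shows "b_star b t = (\<Prod>q\<in>{q \<in> prime_factors b. val_ratio b t q = alpha1 b t}. q ^ multiplicity q b)"
    (is "_ = prod ?f ?E")
proof -
  let ?G = "{q \<in> prime_factors b. val_ratio b t q > alpha1 b t}"
  have "prime_factors b = ?E \<union> ?G" using alpha1_le_val_ratio[of _ b t] by force
  then have "b = prod ?f (?E \<union> ?G)"
    using prod_prime_factors[of b] assms by simp
  also have "\<dots> = prod ?f ?E * prod ?f ?G"
    by (rule prod.union_disjoint) auto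
  finally have eq: "b = prod ?f ?E * prod ?f ?G" .
  then have "prod ?f ?G \<noteq> 0" using assms by (intro notI) simp
  then have "prod ?f ?E * prod ?f ?G div prod ?f ?G = prod ?f ?E"
    by (rule nonzero_mult_div_cancel_right)
  then show ?thesis unfolding b_star_def using eq by simp
qed

lemma multiplicity_b_star:
  assumes "b > 0" "prime q"
  shows "multiplicity q (b_star b t) =
    (if q \<in> prime_factors b \<and> val_ratio b t q = alpha1 b t then multiplicity q b else 0)"
  unfolding b_star_eq_prod[OF assms(1)]
  using assms by (subst multiplicity_prod_prime_powers) auto

lemma b_star_dvd:
  assumes "b > 0"
  shows "b_star b t dvd b"
proof -
  have "b_star b t dvd (\<Prod>q\<in>prime_factors b. q ^ multiplicity q b)"
    unfolding b_star_eq_prod[OF assms] by (rule prod_dvd_prod_subset) auto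
  also have "\<dots> = b"
    using prod_prime_factors[of b] assms by simp
  finally show ?thesis .
qed

text \<open>At a prime q of minimal ratio, n v_q(t) = alpha1 n v_q(b) is at most j v_q(b). So
  \<open>t ^ n\<close> cannot absorb the last of the \<open>Suc j\<close> factors \<open>b\<close>,
  and v_q(P) is at least v_q(b). Other primes do not divide \<open>b_star\<close>.\<close>

lemma b_star_dvd_numerator:
  assumes "b > 0" "t > 0" and eq: "P * t ^ n = p * b ^ Suc j" and j: "alpha1 b t * real n \<le> real j"
  shows "b_star b t dvd P"
proof (cases "P = 0")
  case False
  then have p: "p \<noteq> 0" using eq assms by (auto intro: ccontr)
  show ?thesis
  proof (rule multiplicity_le_imp_dvd)
    show "b_star b t \<noteq> 0" using b_star_dvd[OF assms(1), of t] assms(1) by (metis dvd_0_left less_irrefl)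
    fix q :: nat assume q: "prime q"
    show "multiplicity q (b_star b t) \<le> multiplicity q P"
    proof (cases "q \<in> prime_factors b \<and> val_ratio b t q = alpha1 b t")
      case True
      let ?v = "real (multiplicity q b)"
      have v: "?v > 0" using multiplicity_pos_of_prime_factor True by simp
      have "multiplicity q (P * t ^ n) = multiplicity q (p * b ^ Suc j)" using eq by simp
      then have "multiplicity q P + n * multiplicity q t = multiplicity q p + Suc j * multiplicity q b"
        using q p False assms(1,2)
        by (simp add: prime_elem_multiplicity_mult_distrib prime_elem_multiplicity_power_distrib
            del: power_Suc mult_Suc)
      moreover have "n * multiplicity q t \<le> j * multiplicity q b"
      proof -
        have "real n * real (multiplicity q t) = alpha1 b t * real n * ?v"
          using True v by (simp add: val_ratio_def field_simps)
        also have "\<dots> \<le> real j * ?v"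
          using j v by (intro mult_right_mono) auto
        finally show ?thesis by (simp only: of_nat_le_iff flip: of_nat_mult)
      qed
      ultimately have "multiplicity q b \<le> multiplicity q P" by simp
      then show ?thesis using multiplicity_b_star[OF assms(1) q] by simp
    qed (use multiplicity_b_star[OF assms(1) q] in auto)
  qed
qed simp

section \<open>Lowering the exponent of the denominator\<close>

text \<open>The multiples of \<open>b_star\<close> strictly between \<open>0\<close> and
  \<open>b\<close> form \<open>D1\<close>, and their predecessors form \<open>D2\<close>. If
  \<open>c + e\<close> were such a multiple, \<open>c\<close> would lie in \<open>D1\<close> for
  \<open>e = 0\<close> and in \<open>D2\<close> for \<open>e = 1\<close>.\<close>

lemma digit_or_successor_divisible:
  assumes "b > 0" "c \<in> {0..b - 1} - (D1 b t \<union> D2 b t)" "e \<in> {0, 1}" "b_star b t dvd c + e"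
  shows "c + e = 0 \<or> c + e = b"
proof (rule ccontr)
  assume "\<not> ?thesis"
  then have c: "c + e > 0" "c + e < b" using assms by auto
  obtain k where k: "c + e = k * b_star b t" using assms(4) by (metis dvdE mult.commute)
  obtain l where l: "b = b_star b t * l" using b_star_dvd[OF assms(1), of t] by (auto elim: dvdE)
  have bs: "b_star b t > 0" using l assms(1) by (metis gr0I mult_0)
  have "b div b_star b t = l" using l bs by (metis nonzero_mult_div_cancel_left less_numeral_extra(3))
  moreover have "k < l" using c k l bs by (metis mult.commute mult_less_cancel2)
  ultimately have k': "1 \<le> k \<and> k \<le> b div b_star b t - 1" using c k by (cases k) auto
  then have "c + e \<in> D1 b t" "c + e - 1 \<in> D2 b t" unfolding D1_def D2_def k by blast+
  then show False using assms(2,3) by auto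
qed

text \<open>To pass from \<open>Suc j\<close> to \<open>j\<close>, let N be the prefix of length
  \<open>j\<close>: \<open>b_star\<close> divides both the numerator b N + d j + e and b N, hence
  \<open>d j + e\<close>, which is therefore \<open>0\<close> or \<open>b\<close>, and a factor
  \<open>b\<close> cancels. Fractions are cross-multiplied to stay within the natural
  numbers.\<close>

lemma digit_prefix_descent:
  assumes b: "b > 0" "t > 0" and d: "\<And>i. d i \<in> {0..b - 1} - (D1 b t \<union> D2 b t)"
    and M: "alpha1 b t * real n \<le> real M" and "M \<le> m"
    and "(digit_prefix b d m + e) * t ^ n = p * b ^ m" "e \<in> {0, 1}"
  shows "\<exists>e\<in>{0, 1}. (digit_prefix b d M + e) * t ^ n = p * b ^ M"
  using assms(5-7)
proof (induction arbitrary: e rule: dec_induct)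
  case base
  then show ?case by blast
next
  case (step j)
  let ?N = "digit_prefix b d j"
  have eq: "(b * ?N + d j + e) * t ^ n = p * b ^ Suc j" using step.prems by simp
  have bs: "b_star b t dvd b * ?N + d j + e"
    by (rule b_star_dvd_numerator[OF b eq]) (use M step.hyps in auto)
  have "b_star b t dvd b * ?N" using b_star_dvd[OF b(1)] by simp
  then have "b_star b t dvd d j + e"
    using bs unfolding add.assoc by (rule dvd_add_right_iff[THEN iffD1])
  then have "d j + e = 0 \<or> d j + e = b"
    by (rule digit_or_successor_divisible[OF b(1) d step.prems(2)])
  \<comment> \<open>\<open>e'\<close> is the carry out of the last digit: \<open>1\<close> exactly
    when \<open>d j + e = b\<close>.\<close>
  then obtain e' where e': "e' \<in> {0, 1}" "d j + e = b * e'"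
    using that[of 0] that[of 1] by auto
  have "b * ((?N + e') * t ^ n) = (b * ?N + d j + e) * t ^ n"
    using e'(2) by (simp add: add.assoc distrib_left distrib_right mult.assoc)
  also have "\<dots> = b * (p * b ^ j)" using eq by (simp add: mult_ac)
  finally have "(?N + e') * t ^ n = p * b ^ j" using b by simp
  then show ?case using step.IH e'(1) by blast
qed

section \<open>Fractions close to the digit set\<close>

text \<open>For fixed \<open>n\<close> the admissible \<open>p\<close> lie in a bounded interval, so
  infinitely many pairs means infinitely many \<open>n\<close>.\<close>

lemma W_iff_INFM:
  assumes "u > 0"
  shows "x \<in> W u \<psi> \<longleftrightarrow> x \<in> {0..1} \<and>
    (\<exists>\<^sub>\<infinity>n. n \<ge> 1 \<and> (\<exists>p::int. \<bar>x - of_int p / real u ^ n\<bar> < \<psi> n))"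
proof -
  let ?Q = "{(p::int, n). n \<ge> 1 \<and> \<bar>x - of_int p / real u ^ n\<bar> < \<psi> n}"
  have eq: "snd ` ?Q = {n. n \<ge> 1 \<and> (\<exists>p::int. \<bar>x - of_int p / real u ^ n\<bar> < \<psi> n)}"
    by (auto simp: image_iff)
  have fib: "finite {z \<in> ?Q. snd z = n}" for n
  proof -
    have u: "real u ^ n > 0" using assms by simp
    have "{z \<in> ?Q. snd z = n} \<subseteq> {\<lfloor>(x - \<psi> n) * u ^ n\<rfloor>..\<lceil>(x + \<psi> n) * u ^ n\<rceil>} \<times> {n}"
    proof (clarsimp)
      fix p :: int assume "\<bar>x - of_int p / real u ^ n\<bar> < \<psi> n"
      then have "x - \<psi> n \<le> of_int p / real u ^ n" "of_int p / real u ^ n \<le> x + \<psi> n" by auto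
      then have "(x - \<psi> n) * real u ^ n \<le> of_int p" "of_int p \<le> (x + \<psi> n) * real u ^ n"
        using u by (simp_all add: pos_le_divide_eq pos_divide_le_eq)
      then show "\<lfloor>(x - \<psi> n) * real u ^ n\<rfloor> \<le> p \<and> p \<le> \<lceil>(x + \<psi> n) * real u ^ n\<rceil>"
        by (auto simp: floor_le_iff le_ceiling_iff)
    qed
    then show ?thesis by (rule finite_subset) simp
  qed
  have "finite ?Q \<longleftrightarrow> finite (snd ` ?Q)"
  proof
    assume f: "finite (snd ` ?Q)"
    have "?Q = (\<Union>n\<in>snd ` ?Q. {z \<in> ?Q. snd z = n})" by auto
    then show "finite ?Q" using f fib by (metis (no_types, lifting) finite_UN)
  qed simp
  then show ?thesis unfolding W_def frequently_cofinite eq by auto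
qed

text \<open>With \<open>b ^ m = t ^ n * c\<close> the fraction has numerator p c over
  \<open>b ^ m\<close>. The number \<open>b ^ m * x\<close> lies between the prefix and its
  successor and is within \<open>1 / b\<close> of the integer p c, which leaves only these two
  values for p c.\<close>

lemma near_fraction_is_prefix:
  assumes b: "b \<ge> 2" and t: "t > 0" and pf: "prime_factors b = prime_factors t"
    and d: "\<And>i. d i \<in> {0..b - 1}" and x: "(\<lambda>i. real (d i) / real b ^ Suc i) sums x"
    and m: "alpha2 b t * real n \<le> real m"
    and near: "\<bar>x - of_int p / real t ^ n\<bar> < 1 / real b ^ Suc m"
  obtains e k where "e \<in> {0, 1}" "p = int k" "(digit_prefix b d m + e) * t ^ n = k * b ^ m"
    "\<bar>real b ^ m * x - digit_prefix b d m - e\<bar> < 1 / real b"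
proof -
  let ?N = "digit_prefix b d m"
  obtain c where c: "b ^ m = t ^ n * c"
    using t_power_dvd_b_power[OF _ t pf m] b by (auto elim: dvdE)
  have bm: "real b ^ m > 0" using b by simp
  have tn: "real t ^ n > 0" using t by simp
  have cr: "real b ^ m = real t ^ n * real c" using c by (metis of_nat_mult of_nat_power)
  have c0: "c > 0" using c b by (intro Nat.gr0I notI) simp
  have frac: "real b ^ m * (of_int p / real t ^ n) = of_int (p * int c)"
    using t by (simp add: cr)
  have "real b ^ m * \<bar>x - of_int p / real t ^ n\<bar> < real b ^ m * (1 / real b ^ Suc m)"
    by (rule mult_strict_left_mono[OF near bm])
  also have "\<dots> = 1 / real b" using bm by simp
  also have "real b ^ m * \<bar>x - of_int p / real t ^ n\<bar> = \<bar>real b ^ m * x - of_int (p * int c)\<bar>"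
    unfolding frac[symmetric] right_diff_distrib[symmetric] abs_mult using bm by simp
  finally have lt: "\<bar>real b ^ m * x - of_int (p * int c)\<bar> < 1 / real b" .
  \<comment> \<open>With the extreme digits \<open>0\<close> and \<open>b - 1\<close> the tail
    bounds become \<open>0\<close> and \<open>1\<close>.\<close>
  have "0 \<le> real b ^ m * x - ?N" "real b ^ m * x - ?N \<le> 1"
    using digit_tail_bounds[OF b x, of 0 "b - 1" m] d b by (auto simp: of_nat_diff)
  moreover have "1 / real b < 1" using b by simp
  ultimately have "-1 < real_of_int (p * int c - int ?N)" "real_of_int (p * int c - int ?N) < 2"
    using lt unfolding of_int_diff of_int_of_nat_eq by linarith+
  then have "p * int c - int ?N = 0 \<or> p * int c - int ?N = 1" by linarith
  then obtain e where e: "e \<in> {0, 1}" "p * int c = int (?N + e)"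
    by (metis add.commute diff_eq_eq add.left_neutral insertCI of_nat_0 of_nat_1 of_nat_add)
  then have "0 \<le> p * int c" by simp
  then have "0 \<le> p" using c0 by (simp add: zero_le_mult_iff)
  then obtain k where k: "p = int k" using nonneg_int_cases by blast
  have "k * c = ?N + e" using e k by (metis of_nat_eq_iff of_nat_mult)
  then have "(?N + e) * t ^ n = k * b ^ m" using c by (metis mult.assoc mult.commute)
  moreover have "\<bar>real b ^ m * x - ?N - e\<bar> < 1 / real b"
    using lt e by (simp add: algebra_simps)
  ultimately show ?thesis using that e(1) k by blast
qed

theorem theorem1p1:
  fixes b t :: nat and D :: "nat set" and \<psi> :: "nat \<Rightarrow> real"
  assumes "b \<ge> 3" and "t \<ge> 2" and "prime_factors b = prime_factors t"
    and "D \<subseteq> {0..b - 1}" and "card D \<ge> 2"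
    and "\<And>n. n \<ge> 1 \<Longrightarrow> \<psi> n > 0"
    and "\<forall>\<^sub>F n in sequentially. \<psi> n \<le> real b powr (- of_int \<lceil>alpha2 b t * real n\<rceil> - 1)"
  shows "(0 \<notin> D \<and> b - 1 \<notin> D \<longrightarrow> W t \<psi> \<inter> digit_set b D = {})
    \<and> (ln (real b) / ln (real t) \<notin> \<rat> \<and> D \<subseteq> {0..b - 1} - (D1 b t \<union> D2 b t) \<longrightarrow>
        (\<forall>s::real. s \<ge> 0 \<longrightarrow>
           summable (\<lambda>n. \<psi> (Suc n) powr s
              * real b powr (alpha1 b t * dim_exponent b D * real (Suc n))) \<longrightarrow>
           hausdorff_measure s (W t \<psi> \<inter> digit_set b D) = 0)
        \<and> (\<forall>a::nat. alpha1 b t = real a \<longrightarrow>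
             W t \<psi> \<inter> digit_set b D = W (b ^ a) \<psi> \<inter> digit_set b D))"
proof -
  define \<alpha> where "\<alpha> = alpha1 b t"
  \<comment> \<open>The descent starts with \<open>m n\<close> digits and stops at
    \<open>M n\<close>; \<open>nat\<close> truncates nothing, as both ratios are positive.\<close>
  define m where "m n = nat \<lceil>alpha2 b t * real n\<rceil>" for n
  define M where "M n = nat \<lceil>\<alpha> * real n\<rceil>" for n
  have b: "b \<ge> 2" "b > 0" and t: "t > 0" using assms by auto
  have \<alpha>: "0 < \<alpha>" "\<alpha> \<le> alpha2 b t"
    using alpha1_pos[OF b(1) assms(3)] alpha1_le_alpha2[OF b(1)] by (auto simp: \<alpha>_def)
  have Mm: "M n \<le> m n" for n unfolding M_def m_def
    using \<alpha> by (intro nat_mono ceiling_mono mult_right_mono) auto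
  have m: "alpha2 b t * real n \<le> real (m n)" and M: "\<alpha> * real n \<le> real (M n)"
    and M_le: "real (M n) \<le> \<alpha> * real n + 1" for n
    unfolding m_def M_def using \<alpha> mult_nonneg_nonneg[of \<alpha> "real n"]
    by (simp_all only: of_nat_nat of_nat_ceiling) linarith
  have \<psi>: "\<forall>\<^sub>F n in sequentially. \<psi> n \<le> 1 / real b ^ Suc (m n)"
    using assms(7)
  proof eventually_elim
    case (elim n)
    have "\<lceil>alpha2 b t * real n\<rceil> \<ge> 0" using \<alpha> by (simp add: less_le_trans[of _ 0])
    then have "- of_int \<lceil>alpha2 b t * real n\<rceil> - 1 = - real (Suc (m n))" by (simp add: m_def)
    then show ?case using elim b by (simp add: powr_minus powr_realpow divide_inverse del: power_Suc of_nat_Suc)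
  qed

  \<comment> \<open>Emptiness when neither \<open>0\<close> nor \<open>b - 1\<close> is a
    digit\<close>
  have part1: "W t \<psi> \<inter> digit_set b D = {}" if D: "0 \<notin> D" "b - 1 \<notin> D"
  proof (rule ccontr)
    assume "\<not> ?thesis"
    then obtain x d where x: "x \<in> W t \<psi>" and d: "\<And>i. d i \<in> D"
      and sums: "(\<lambda>i. real (d i) / real b ^ Suc i) sums x"
      unfolding digit_set_def by blast
    have "\<exists>\<^sub>\<infinity>n. \<exists>p::int. \<bar>x - of_int p / real t ^ n\<bar> < \<psi> n"
      using x by (auto simp: W_iff_INFM[OF t] elim: INFM_mono)
    \<comment> \<open>A single such \<open>n\<close> at which the bound on \<open>\<psi>\<close>
      holds suffices for the contradiction.\<close>
    then obtain n p where "\<bar>x - of_int p / real t ^ n\<bar> < \<psi> n" "\<psi> n \<le> 1 / real b ^ Suc (m n)"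
      using frequently_eventually_conj[OF _ \<psi>[folded cofinite_eq_sequentially]] frequently_ex by blast
    then have near: "\<bar>x - of_int p / real t ^ n\<bar> < 1 / real b ^ Suc (m n)" by simp
    have d': "d i \<in> {0..b - 1}" for i using d assms(4) by blast
    obtain e k where e: "e \<in> {0, 1}" and
      lt: "\<bar>real b ^ m n * x - digit_prefix b d (m n) - real e\<bar> < 1 / real b"
      using near_fraction_is_prefix[OF b(1) t assms(3) d' sums m near] by metis
    have lo: "1 \<le> d i" for i using d[of i] D by (cases "d i") auto
    have hi: "d i \<le> b - 2" for i using d[of i] d'[of i] D by (cases "d i = b - 1") auto
    \<comment> \<open>The scaled tail lies between \<open>1 / (b - 1)\<close> and
      \<open>1 - 1 / (b - 1)\<close>, hence farther than \<open>1 / b\<close> from both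
      \<open>0\<close> and \<open>1\<close>.\<close>
    note bounds = digit_tail_bounds[OF b(1) sums lo hi, of "m n"]
    have "1 / real b \<le> 1 / (real b - 1)" using b by (simp add: field_simps)
    moreover have "real (b - 2) / (real b - 1) = 1 - 1 / (real b - 1)"
      using b by (simp add: of_nat_diff field_simps)
    ultimately show False using bounds lt e
      by (simp only: insert_iff empty_iff) linarith
  qed

  \<comment> \<open>From denominators \<open>t ^ n\<close> to denominators
    \<open>b ^ M n\<close>\<close>
  have lower: "\<exists>e\<in>{0, 1}. of_int p / real t ^ n = real (digit_prefix b d (M n) + e) / real b ^ M n"
    if D: "D \<subseteq> {0..b - 1} - (D1 b t \<union> D2 b t)" and d: "\<And>i. d i \<in> D"
      and sums: "(\<lambda>i. real (d i) / real b ^ Suc i) sums x"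
      and near: "\<bar>x - of_int p / real t ^ n\<bar> < 1 / real b ^ Suc (m n)"
    for x d n p
  proof -
    have d': "d i \<in> {0..b - 1}" "d i \<in> {0..b - 1} - (D1 b t \<union> D2 b t)" for i using d D by blast+
    obtain e k where e: "e \<in> {0, 1}" "p = int k"
      "(digit_prefix b d (m n) + e) * t ^ n = k * b ^ m n"
      using near_fraction_is_prefix[OF b(1) t assms(3) d'(1) sums m near] by metis
    obtain e' where e': "e' \<in> {0, 1}" "(digit_prefix b d (M n) + e') * t ^ n = k * b ^ M n"
      using digit_prefix_descent[OF b(2) t d'(2) M[unfolded \<alpha>_def] Mm e(3,1)] by blast
    have "real (digit_prefix b d (M n) + e') * real t ^ n = real k * real b ^ M n"
      using e'(2) by (metis of_nat_mult of_nat_power)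
    then show ?thesis using e'(1) e(2) t b
      by (intro bexI[of _ e']) (simp_all add: frac_eq_eq del: of_nat_add)
  qed
  \<comment> \<open>The centres now depend only on \<open>n\<close>, \<open>b\<close>,
    \<open>t\<close> and \<open>D\<close>, no longer on the digits of the individual
    \<open>x\<close>, as a covering argument requires.\<close>
  have approx: "\<exists>\<^sub>\<infinity>n. n \<ge> 1 \<and> (\<exists>N\<in>digit_prefixes b D (M n). \<exists>e\<in>{0, 1}.
      \<bar>x - real (N + e) / real b ^ M n\<bar> < \<psi> n)"
    if D: "D \<subseteq> {0..b - 1} - (D1 b t \<union> D2 b t)" and x: "x \<in> W t \<psi> \<inter> digit_set b D" for x
  proof -
    obtain d where d: "\<And>i. d i \<in> D" and sums: "(\<lambda>i. real (d i) / real b ^ Suc i) sums x"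
      using x unfolding digit_set_def by blast
    have "\<exists>\<^sub>\<infinity>n. n \<ge> 1 \<and> (\<exists>p::int. \<bar>x - of_int p / real t ^ n\<bar> < \<psi> n)"
      using x by (simp add: W_iff_INFM[OF t])
    then have "\<exists>\<^sub>\<infinity>n. \<psi> n \<le> 1 / real b ^ Suc (m n)
        \<and> n \<ge> 1 \<and> (\<exists>p::int. \<bar>x - of_int p / real t ^ n\<bar> < \<psi> n)"
      by (rule frequently_eventually_conj[OF _ \<psi>[folded cofinite_eq_sequentially]])
    then show ?thesis
    proof (rule INFM_mono, elim conjE exE, intro conjI)
      fix n p assume lt: "\<bar>x - of_int p / real t ^ n\<bar> < \<psi> n" "\<psi> n \<le> 1 / real b ^ Suc (m n)"
      from less_le_trans[OF lt] obtain e where "e \<in> {0, 1}"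
          "of_int p / real t ^ n = real (digit_prefix b d (M n) + e) / real b ^ M n"
        using lower[OF D d sums] by blast
      moreover have "digit_prefix b d (M n) \<in> digit_prefixes b D (M n)"
        using d by (auto simp: digit_prefixes_def)
      ultimately show "\<exists>N\<in>digit_prefixes b D (M n). \<exists>e\<in>{0, 1}.
          \<bar>x - real (N + e) / real b ^ M n\<bar> < \<psi> n" using lt by metis
    qed
  qed

  \<comment> \<open>Vanishing of the Hausdorff measure\<close>
  have finD: "finite D" using assms(4) finite_subset by blast
  have part2: "hausdorff_measure s (W t \<psi> \<inter> digit_set b D) = 0"
    if D: "D \<subseteq> {0..b - 1} - (D1 b t \<union> D2 b t)" and s: "s \<ge> 0"
      and sm: "summable (\<lambda>n. \<psi> (Suc n) powr s
              * real b powr (alpha1 b t * dim_exponent b D * real (Suc n)))" for s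
  proof -
    \<comment> \<open>Each prefix contributes at most two centres.\<close>
    define S where "S n = (\<lambda>(N, e). real (N + e) / real b ^ M n) ` (digit_prefixes b D (M n) \<times> {0, 1})" for n
    have finS: "finite (S n)" for n
      using digit_prefixes_finite_card[OF finD] by (simp add: S_def)
    have "card (S n) \<le> card (digit_prefixes b D (M n) \<times> {0, 1::nat})" for n
      unfolding S_def using digit_prefixes_finite_card[OF finD] by (intro card_image_le) simp
    also have "card (digit_prefixes b D (M n) \<times> {0, 1::nat}) \<le> card D ^ M n * 2" for n
      using digit_prefixes_finite_card[OF finD, of b "M n"] by (simp add: card_cartesian_product)
    finally have cardS: "card (S n) \<le> card D ^ M n * 2" for n .
    \<comment> \<open>By the definition of \<open>dim_exponent\<close>, \<open>card D\<close> is
      \<open>b powr dim_exponent b D\<close>; this turns the count of prefixes into the power of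
      \<open>b\<close> in the series.\<close>
    have cardD: "real (card D) powr y = real b powr (dim_exponent b D * y)" for y
      using assms(1,5) by (simp add: powr_def dim_exponent_def)
    \<comment> \<open>Rounding up in \<open>M n\<close> costs at most one factor
      \<open>card D\<close>, a constant.\<close>
    have cardS': "real (card (S n)) \<le> 2 * real (card D) * real b powr (\<alpha> * dim_exponent b D * real n)" for n
    proof -
      have "real (card (S n)) \<le> real (card D ^ M n * 2)"
        using cardS[of n] by (simp only: of_nat_le_iff)
      then have "real (card (S n)) \<le> 2 * real (card D) ^ M n" by simp
      also have "real (card D) ^ M n = real (card D) powr real (M n)"
        using assms(5) by (simp add: powr_realpow)
      also have "\<dots> \<le> real (card D) powr (\<alpha> * real n + 1)"
        using assms(5) M_le by (intro powr_mono) auto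
      also have "\<dots> = real (card D) * real b powr (\<alpha> * dim_exponent b D * real n)"
        using assms(5) by (simp add: powr_add cardD mult_ac)
      finally show ?thesis by simp
    qed
    \<comment> \<open>The given series starts at \<open>n = 1\<close>, the one in the covering lemma
      at \<open>0\<close>; one more term does not affect convergence.\<close>
    have "summable (\<lambda>n. \<psi> n powr s * real b powr (\<alpha> * dim_exponent b D * real n))"
      using sm unfolding \<alpha>_def by (subst (asm) summable_Suc_iff)
    then have "summable (\<lambda>n. 2 * real (card D) * (\<psi> n powr s * real b powr (\<alpha> * dim_exponent b D * real n)))"
      by (rule summable_mult)
    then have "summable (\<lambda>n. real (card (S n)) * \<psi> n powr s)"
    proof (rule summable_comparison_test'[where N = 0])
      fix n
      show "norm (real (card (S n)) * \<psi> n powr s) \<le>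
          2 * real (card D) * (\<psi> n powr s * real b powr (\<alpha> * dim_exponent b D * real n))"
        using mult_right_mono[OF cardS'[of n], of "\<psi> n powr s"] by (simp add: mult_ac)
    qed
    \<comment> \<open>The radii tend to \<open>0\<close> by the assumed bound on
      \<open>\<psi>\<close>: \<open>Suc (m n)\<close> exceeds \<open>\<alpha> * real n\<close>, so
      eventually \<open>\<psi> n\<close> is at most the geometric term
      \<open>(real b powr - \<alpha>) ^ n\<close>.\<close>
    moreover have "\<psi> \<longlonglongrightarrow> 0"
    proof (rule tendsto_sandwich)
      show "\<forall>\<^sub>F n in sequentially. 0 \<le> \<psi> n"
        using assms(6) by (intro eventually_sequentiallyI[of 1]) (simp add: less_imp_le)
      show "\<forall>\<^sub>F n in sequentially. \<psi> n \<le> (real b powr - \<alpha>) ^ n"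
        using \<psi>
      proof eventually_elim
        case (elim n)
        have "1 / real b ^ Suc (m n) = real b powr - real (Suc (m n))"
          using b by (simp add: powr_minus powr_realpow divide_inverse del: power_Suc of_nat_Suc)
        also have "\<dots> \<le> real b powr (- \<alpha> * real n)"
          using b M[of n] Mm[of n] by (intro powr_mono) auto
        also have "\<dots> = (real b powr - \<alpha>) ^ n"
          using b by (simp add: powr_powr flip: powr_realpow)
        finally show ?case using elim by simp
      qed
      show "(\<lambda>n. (real b powr - \<alpha>) ^ n) \<longlonglongrightarrow> 0"
        using b \<alpha> by (intro LIMSEQ_power_zero) (auto intro: powr_less_one)
    qed simp
    ultimately show ?thesis
    proof (intro hausdorff_measure_limsup_balls_eq_0[OF s finS])
      fix x assume "x \<in> W t \<psi> \<inter> digit_set b D"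
      then show "\<exists>\<^sub>\<infinity>n. \<exists>c\<in>S n. dist c x < \<psi> n"
        by (rule INFM_mono[OF approx[OF D]])
          (auto simp: S_def dist_real_def abs_minus_commute intro!: bexI[rotated])
    qed
  qed

  \<comment> \<open>The case where \<open>alpha1\<close> is a natural number\<close>
  have part3: "W t \<psi> \<inter> digit_set b D = W (b ^ a) \<psi> \<inter> digit_set b D"
    if D: "D \<subseteq> {0..b - 1} - (D1 b t \<union> D2 b t)" and a: "alpha1 b t = real a" for a
  proof -
    \<comment> \<open>Nothing is rounded here, so \<open>b ^ M n = (b ^ a) ^ n\<close> and
      \<open>approx\<close> yields the inclusion from left to right.\<close>
    have Ma: "M n = a * n" for n
      unfolding M_def \<alpha>_def a by (simp flip: of_nat_mult)
    have ba: "b ^ a > 0" using b by simp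
    have "x \<in> W (b ^ a) \<psi>" if "x \<in> W t \<psi> \<inter> digit_set b D" for x
      unfolding W_iff_INFM[OF ba]
    proof
      show "x \<in> {0..1}" using that by (simp add: W_def)
      show "\<exists>\<^sub>\<infinity>n. n \<ge> 1 \<and> (\<exists>p::int. \<bar>x - of_int p / real (b ^ a) ^ n\<bar> < \<psi> n)"
        using approx[OF D that]
      proof (rule INFM_mono)
        fix n assume "n \<ge> 1 \<and> (\<exists>N\<in>digit_prefixes b D (M n). \<exists>e\<in>{0, 1}.
          \<bar>x - real (N + e) / real b ^ M n\<bar> < \<psi> n)"
        then obtain N e where "n \<ge> 1" "\<bar>x - real (N + e) / real b ^ M n\<bar> < \<psi> n" by blast
        then show "n \<ge> 1 \<and> (\<exists>p::int. \<bar>x - of_int p / real (b ^ a) ^ n\<bar> < \<psi> n)"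
          by (intro conjI exI[of _ "int (N + e)"]) (simp_all add: Ma power_mult)
      qed
    qed
    \<comment> \<open>Conversely \<open>b ^ a\<close> divides \<open>t\<close>: writing
      \<open>t = b ^ a * c\<close>, each fraction over \<open>(b ^ a) ^ n\<close> becomes one over
      \<open>t ^ n\<close> after multiplying its numerator by \<open>c ^ n\<close>, with the same
      \<open>n\<close>.\<close>
    moreover have "x \<in> W t \<psi>" if x: "x \<in> W (b ^ a) \<psi>" for x
    proof -
      obtain c where c: "t = b ^ a * c"
        using b_power_dvd_t[OF b(2) t assms(3), of a] a by (auto elim: dvdE)
      then have "c > 0" using t by (cases c) auto
      then have "of_int p / real (b ^ a) ^ n = of_int (p * int c ^ n) / real t ^ n" for p n
        using b by (simp add: c power_mult_distrib)
      then have "\<exists>p'::int. \<bar>x - of_int p' / real t ^ n\<bar> < \<psi> n"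
        if "\<bar>x - of_int p / real (b ^ a) ^ n\<bar> < \<psi> n" for p n
        using that by (intro exI[of _ "p * int c ^ n"]) simp
      then show ?thesis using x unfolding W_iff_INFM[OF ba] W_iff_INFM[OF t]
        by (auto elim!: INFM_mono)
    qed
    ultimately show ?thesis by blast
  qed
  show ?thesis
    by (intro conjI impI allI; elim conjE) (rule part1 part2 part3; assumption)+
qed

end
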